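(* Let $X$ be a Fréchet topological space, let $Y$ be a Hausdorff topological space, and let $f:X\to Y$ be a compact-preserving function. Then for each point $x\in X$ and each neighborhood $O_{f(x)}$ of $f(x)$ in $Y$ there is a neighborhood $O_x$ of $x$ in $X$ such that $f(O_x)\subset f[x]\cup O_{f(x)}$. If, moreover, $X$ is strong Fréchet, then for each point $x\in X$ and each neighborhood $O_{f(x)}$ of $f(x)$ in $Y$ there is a neighborhood $O_x$ of $x$ in $X$ such that $f(O_x)\subset f[x]\cup O_{f(x)}$ and the set $f[x]\setminus O_{f(x)}$ is finite.
   Context: A function $f:X\to Y$ between topological spaces (not assumed continuous) is compact-preserving if the image $f(K)$ of each compact subset $K\subset X$ is compact. Compact means that every open cover has a finite subcover (no separation axiom included). A topological space $X$ is Fréchet if for each subset $A\subset X$ and each point $a\in\bar A$ there is a sequence of points of $A$ that converges to $a$. It is strong Fréchet if for any decreasing sequence $(A_n)_{n\in\omega}$ of subsets of $X$ and any point $a\in\bigcap_{n\in\omega}\bar A_n$ there is a sequence of points $a_n\in A_n$, $n\in\omega$, that converges to $a$. For a function $f:X\to Y$ and a point $x\in X$, $f[x]=\{y\in Y: x\in \mathrm{cl}_X(f^{-1}(y))\}=\bigcap\{f(O_x): O_x \text{ is a neighborhood of } x \text{ in } X\}$. *)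

theory Defs
  imports "HOL-Analysis.Analysis"
begin

(* Neighbourhoods are not required to be open. *)
definition neighbourhood_in :: "'a topology \<Rightarrow> 'a \<Rightarrow> 'a set \<Rightarrow> bool" where
  "neighbourhood_in X x N \<longleftrightarrow>
     N \<subseteq> topspace X \<and> (\<exists>U. openin X U \<and> x \<in> U \<and> U \<subseteq> N)"

definition compact_preserving_map :: "'a topology \<Rightarrow> 'b topology \<Rightarrow> ('a \<Rightarrow> 'b) \<Rightarrow> bool" where
  "compact_preserving_map X Y f \<longleftrightarrow>
     f \<in> topspace X \<rightarrow> topspace Y \<and> (\<forall>K. compactin X K \<longrightarrow> compactin Y (f ` K))"

definition Frechet_space :: "'a topology \<Rightarrow> bool" where
  "Frechet_space X \<longleftrightarrow>
     (\<forall>A a. A \<subseteq> topspace X \<longrightarrow> a \<in> X closure_of A \<longrightarrow>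
        (\<exists>s. (\<forall>n::nat. s n \<in> A) \<and> limitin X s a sequentially))"

definition strong_Frechet_space :: "'a topology \<Rightarrow> bool" where
  "strong_Frechet_space X \<longleftrightarrow>
     (\<forall>(A :: nat \<Rightarrow> 'a set) a. (\<forall>n. A n \<subseteq> topspace X) \<longrightarrow> decseq A \<longrightarrow>
        a \<in> (\<Inter>n. X closure_of (A n)) \<longrightarrow>
        (\<exists>s. (\<forall>n. s n \<in> A n) \<and> limitin X s a sequentially))"

(* The set written f[x]; it is in general larger than the singleton of f x. *)
definition local_image :: "'a topology \<Rightarrow> 'b topology \<Rightarrow> ('a \<Rightarrow> 'b) \<Rightarrow> 'a \<Rightarrow> 'b set" where
  "local_image X Y f x =
     {y \<in> topspace Y. x \<in> X closure_of {z \<in> topspace X. f z = y}}"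

lemma local_image_eq_Inter:
  assumes "f \<in> topspace X \<rightarrow> topspace Y" "x \<in> topspace X"
  shows "local_image X Y f x = (\<Inter>N\<in>{N. neighbourhood_in X x N}. f ` N)"
proof (intro equalityI subsetI)
  fix y assume y: "y \<in> local_image X Y f x"
  show "y \<in> (\<Inter>N\<in>{N. neighbourhood_in X x N}. f ` N)"
  proof (intro INT_I)
    fix N assume "N \<in> {N. neighbourhood_in X x N}"
    then obtain U where "openin X U" "x \<in> U" "U \<subseteq> N"
      by (auto simp: neighbourhood_in_def)
    then show "y \<in> f ` N"
      using y by (force simp: local_image_def in_closure_of)
  qed
next
  fix y assume y: "y \<in> (\<Inter>N\<in>{N. neighbourhood_in X x N}. f ` N)"
  have U: "y \<in> f ` U" if "openin X U" "x \<in> U" for U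
  proof -
    have "neighbourhood_in X x U"
      using that openin_subset by (auto simp: neighbourhood_in_def)
    with y show ?thesis by blast
  qed
  have "y \<in> topspace Y"
    using U[of "topspace X"] assms by auto
  moreover have "\<exists>z. z \<in> {z \<in> topspace X. f z = y} \<and> z \<in> T" if "x \<in> T \<and> openin X T" for T
    using U[of T] that openin_subset[of X T] by auto
  ultimately show "y \<in> local_image X Y f x"
    using assms(2) unfolding local_image_def in_closure_of by blast
qed

end

theory Submission
  imports Defs
begin

text \<open>
  If \<open>s\<close> converges to \<open>x\<close> while the values \<open>f (s n)\<close> stay outside an open neighbourhood \<open>W\<close> of
  \<open>f x\<close>, then every set of such values is the image of a compact set (a part of \<open>s\<close> together with
  \<open>x\<close>) with \<open>W\<close> removed, hence compact. A Hausdorff space has no infinite set all of whose subsets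
  are compact, so the values are finitely many. By the Frechet property a failure of the first
  claim produces such an \<open>s\<close> with values outside \<open>f[x]\<close>; but \<open>x\<close> is then in the closure of one of
  finitely many fibres. If \<open>f[x] - W\<close> contained distinct points \<open>y 0, y 1, \<dots>\<close>, the strong
  Frechet property applied to the preimages of the tails of \<open>y\<close> would give such an \<open>s\<close> with
  infinitely many values.
\<close>

text \<open>Compact sets are closed in a Hausdorff space, so the complements of the sets
  \<open>C - {y}\<close> form an open cover of \<open>C\<close>. Each of them meets \<open>C\<close>
  only in \<open>y\<close>, hence a finite subcover leaves only finitely many points.\<close>

lemma finite_if_compactin_remove1:
  assumes Y: "Hausdorff_space Y" and C: "compactin Y C"
    and remove: "\<And>y. y \<in> C \<Longrightarrow> compactin Y (C - {y})"
  shows "finite C"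
proof -
  define \<U> where "\<U> = (\<lambda>y. topspace Y - (C - {y})) ` C"
  have "openin Y U" if "U \<in> \<U>" for U
    using that remove compactin_imp_closedin[OF Y] by (auto simp: \<U>_def)
  moreover have "C \<subseteq> \<Union>\<U>"
    using compactin_subset_topspace[OF C] by (auto simp: \<U>_def)
  ultimately obtain \<F> where \<F>: "finite \<F>" "\<F> \<subseteq> \<U>" "C \<subseteq> \<Union>\<F>"
    using C unfolding compactin_def by meson
  have "finite (U \<inter> C)" if "U \<in> \<F>" for U
  proof -
    from that \<F> obtain y where "U = topspace Y - (C - {y})"
      by (auto simp: \<U>_def)
    then have "U \<inter> C \<subseteq> {y}" by auto
    then show ?thesis by (rule finite_subset) simp
  qed
  then have "finite (\<Union>U\<in>\<F>. U \<inter> C)"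
    using \<F>(1) by blast
  moreover have "C \<subseteq> (\<Union>U\<in>\<F>. U \<inter> C)"
    using \<F>(3) by auto
  ultimately show ?thesis
    by (rule rev_finite_subset)
qed

lemma finite_values_along_sequence:
  assumes Y: "Hausdorff_space Y" and f: "compact_preserving_map X Y f"
    and s: "limitin X s x sequentially" "range s \<subseteq> topspace X"
    and W: "openin Y W" "f x \<in> W" and out: "\<And>n. f (s n) \<notin> W"
  shows "finite (range (f \<circ> s))"
proof -
  have compact: "compactin Y B" if B: "B \<subseteq> range (f \<circ> s)" for B
  proof -
    let ?S = "{z \<in> range s. f z \<in> B}"
    have "compactin X (insert x ?S)"
      using s by (intro compactin_sequence_with_limit) auto
    then have K: "compactin Y (f ` insert x ?S)"
      using f unfolding compact_preserving_map_def by blast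
    \<comment> \<open>Adding the limit \<open>x\<close> made the set compact but contributed the
      extra value \<open>f x\<close>. That value lies in \<open>W\<close>, which \<open>B\<close>
      misses, so intersecting with the closed complement of \<open>W\<close> discards exactly
      it.\<close>
    have "f ` insert x ?S \<inter> (topspace Y - W) = B"
    proof -
      have "f ` ?S = B"
        using B by auto
      moreover have "B \<inter> W = {}"
        using B out by auto
      moreover have "f ` ?S \<subseteq> topspace Y"
        using compactin_subset_topspace[OF K] by auto
      ultimately show ?thesis
        using W(2) by auto
    qed
    then show ?thesis
      using compact_Int_closedin[OF K, of "topspace Y - W"] W(1) by auto
  qed
  show ?thesis
    by (rule finite_if_compactin_remove1[OF Y]) (auto intro: compact)
qed

lemma limitin_in_closure_of_range:
  assumes "limitin X s x sequentially" "range s \<subseteq> topspace X"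
  shows "x \<in> X closure_of range s"
  unfolding in_closure_of
proof (intro conjI allI impI)
  show "x \<in> topspace X"
    using assms(1) by (rule limitin_topspace)
  fix U assume "x \<in> U \<and> openin X U"
  then obtain n where "s n \<in> U"
    using assms(1) unfolding limitin_sequentially by blast
  then show "\<exists>y. y \<in> range s \<and> y \<in> U"
    by blast
qed

text \<open>The sequence runs through finitely many fibres of \<open>f\<close>. Closure commutes
  with finite unions, so the limit \<open>x\<close> is in the closure of one of these
  fibres.\<close>

lemma exists_value_in_local_image:
  assumes f: "f \<in> topspace X \<rightarrow> topspace Y"
    and s: "limitin X s x sequentially" "range s \<subseteq> topspace X"
    and fin: "finite (range (f \<circ> s))"
  shows "\<exists>n. f (s n) \<in> local_image X Y f x"
proof -
  let ?fibre = "\<lambda>y. {z \<in> topspace X. f z = y}"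
  have "range s \<subseteq> \<Union> (?fibre ` range (f \<circ> s))"
    using s(2) by auto
  then have "x \<in> X closure_of \<Union> (?fibre ` range (f \<circ> s))"
    using closure_of_mono limitin_in_closure_of_range[OF s] by blast
  also have "\<dots> = (\<Union>F\<in>?fibre ` range (f \<circ> s). X closure_of F)"
    using fin by (intro closure_of_Union) simp
  finally obtain n where "x \<in> X closure_of ?fibre (f (s n))"
    by auto
  moreover have "f (s n) \<in> topspace Y"
    using f s(2) by auto
  ultimately show ?thesis
    unfolding local_image_def by blast
qed

lemma Frechet_local_image:
  assumes X: "Frechet_space X" and Y: "Hausdorff_space Y"
    and f: "compact_preserving_map X Y f"
    and x: "x \<in> topspace X" and V: "neighbourhood_in Y (f x) V"
  shows "\<exists>U. neighbourhood_in X x U \<and> f ` U \<subseteq> local_image X Y f x \<union> V"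
proof -
  obtain W where W: "openin Y W" "f x \<in> W" "W \<subseteq> V"
    using V unfolding neighbourhood_in_def by blast
  \<comment> \<open>The points violating the claim for the open set \<open>W\<close> inside
    \<open>V\<close>: openness is what the finiteness of values along a sequence requires.\<close>
  define A where "A = {z \<in> topspace X. f z \<notin> local_image X Y f x \<union> W}"
  have A: "A \<subseteq> topspace X"
    by (auto simp: A_def)
  have "x \<notin> X closure_of A"
  proof
    assume "x \<in> X closure_of A"
    then obtain s where s: "\<And>n. s n \<in> A" "limitin X s x sequentially"
      using X A unfolding Frechet_space_def by blast
    have range: "range s \<subseteq> topspace X"
      using s(1) A by auto
    have "finite (range (f \<circ> s))"
      using s by (intro finite_values_along_sequence[OF Y f _ range W(1,2)]) (auto simp: A_def)
    then obtain n where "f (s n) \<in> local_image X Y f x"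
      using exists_value_in_local_image[OF _ s(2) range] f
      unfolding compact_preserving_map_def by blast
    then show False
      using s(1)[of n] by (simp add: A_def)
  qed
  then obtain U where U: "openin X U" "x \<in> U" "U \<inter> A = {}"
    using x unfolding in_closure_of by blast
  have "neighbourhood_in X x U"
    using U openin_subset unfolding neighbourhood_in_def by blast
  moreover have "f ` U \<subseteq> local_image X Y f x \<union> V"
    using U openin_subset[OF U(1)] W(3) by (auto simp: A_def)
  ultimately show ?thesis
    by blast
qed

lemma strong_Frechet_finite_local_image:
  assumes X: "strong_Frechet_space X" and Y: "Hausdorff_space Y"
    and f: "compact_preserving_map X Y f"
    and V: "neighbourhood_in Y (f x) V"
  shows "finite (local_image X Y f x - V)"
proof (rule ccontr)
  assume "infinite (local_image X Y f x - V)"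
  then obtain y :: "nat \<Rightarrow> _" where y: "inj y" "range y \<subseteq> local_image X Y f x - V"
    using infinite_countable_subset by blast
  obtain W where W: "openin Y W" "f x \<in> W" "W \<subseteq> V"
    using V unfolding neighbourhood_in_def by blast
  \<comment> \<open>Preimages of the tails of \<open>y\<close>. The set \<open>A n\<close> contains
    the whole fibre over \<open>y n\<close>, which accumulates at \<open>x\<close> because
    \<open>y n\<close> is in \<open>local_image X Y f x\<close>.\<close>
  define A where "A n = {z \<in> topspace X. f z \<in> y ` {n..}}" for n
  have "decseq A"
    unfolding decseq_def A_def by fastforce
  moreover have "x \<in> (\<Inter>n. X closure_of A n)"
  proof
    fix n
    have "x \<in> X closure_of {z \<in> topspace X. f z = y n}"
      using y(2) unfolding local_image_def by blast
    moreover have "{z \<in> topspace X. f z = y n} \<subseteq> A n"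
      by (auto simp: A_def)
    ultimately show "x \<in> X closure_of A n"
      using closure_of_mono by blast
  qed
  moreover have "\<forall>n. A n \<subseteq> topspace X"
    by (auto simp: A_def)
  ultimately obtain s where s: "\<And>n. s n \<in> A n" "limitin X s x sequentially"
    using X[unfolded strong_Frechet_space_def, rule_format, of A x] by blast
  have "finite (range (f \<circ> s))"
  proof (rule finite_values_along_sequence[OF Y f s(2) _ W(1,2)])
    show "range s \<subseteq> topspace X"
      using s(1) by (auto simp: A_def)
    show "f (s n) \<notin> W" for n
      using s(1)[of n] y(2) W(3) by (auto simp: A_def)
  qed
  \<comment> \<open>By injectivity only finitely many indices of \<open>y\<close> occur among the
    values, all below some \<open>m\<close>. But \<open>s m\<close> lies in \<open>A m\<close>, so
    its value has an index \<open>k \<ge> m\<close>.\<close>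
  then have "finite (y -` range (f \<circ> s))"
    using y(1) by (rule finite_vimageI)
  then obtain m where m: "\<And>k. k \<in> y -` range (f \<circ> s) \<Longrightarrow> k < m"
    unfolding finite_nat_set_iff_bounded by auto
  obtain k where "k \<ge> m" "f (s m) = y k"
    using s(1)[of m] by (auto simp: A_def)
  then show False
    using m[of k] by (metis comp_apply leD rangeI vimageI)
qed

theorem theorem1:
  fixes X :: "'a topology" and Y :: "'b topology" and f :: "'a \<Rightarrow> 'b"
  assumes "Frechet_space X"
    and "Hausdorff_space Y"
    and "compact_preserving_map X Y f"
  shows "(\<forall>x \<in> topspace X. \<forall>V. neighbourhood_in Y (f x) V \<longrightarrow>
            (\<exists>U. neighbourhood_in X x U \<and> f ` U \<subseteq> local_image X Y f x \<union> V)) \<and>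
         (strong_Frechet_space X \<longrightarrow>
            (\<forall>x \<in> topspace X. \<forall>V. neighbourhood_in Y (f x) V \<longrightarrow>
               (\<exists>U. neighbourhood_in X x U \<and> f ` U \<subseteq> local_image X Y f x \<union> V \<and>
                    finite (local_image X Y f x - V))))"
  using Frechet_local_image[OF assms] strong_Frechet_finite_local_image[OF _ assms(2,3)]
  by blast

end
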